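(* Consider a fluid timed Petri net with no priority rules, with set of transitions $\mathcal{Q}$. Then its dynamics is equivalent to the dynamic programming equation of a semi-Markov decision process with controlled discount factors. That is, there exists semi-Markov decision process data with state set $S=\mathcal{Q}$ and action sets $A_q=q^{\mathrm{in}}$ ($q\in\mathcal{Q}$), consisting of costs $r_q^p\in\mathbb{R}$, holding times $t_q^p\ge 0$, discount factors $\gamma_q^p\ge 0$ and probability vectors $(P^p_{qq'})_{q'\in\mathcal{Q}}$ for $q\in\mathcal{Q}$, $p\in q^{\mathrm{in}}$, such that for every family of functions $z_q:\mathbb{R}\to\mathbb{R}$ ($q\in\mathcal{Q}$) and every $t\in\mathbb{R}$, the counter equations of the net $$z_q(t)=\min_{p\in q^{\mathrm{in}}}\ \pi_{qp}\,\alpha_{qp}^{-1}\Big(m_p+\sum_{q'\in p^{\mathrm{in}}}\alpha_{pq'}\,z_{q'}(t-\tau_p)\Big),\qquad q\in\mathcal{Q},$$ hold at time $t$ if and only if the dynamic programming equations $$v(q,t)=\min_{p\in A_q}\Big\{r_q^p+\gamma_q^p\sum_{q'\in S}P^p_{qq'}\,v(q',t-t_q^p)\Big\},\qquad q\in S,$$ hold at time $t$ with $v(q,\cdot)=z_q$.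
   Context: A fluid timed Petri net without priority rules consists of: two finite disjoint sets $\mathcal{P}$ (places) and $\mathcal{Q}$ (transitions); a directed bipartite graph on $\mathcal{P}\cup\mathcal{Q}$, where $x^{\mathrm{in}}$ (resp. $x^{\mathrm{out}}$) denotes the set of vertices $y$ with an arc from $y$ to $x$ (resp. from $x$ to $y$), and every transition has at least one upstream place; an initial marking $m_p\ge 0$ and a holding time $\tau_p\ge 0$ for each place $p$; a weight $\alpha_{qp}>0$ for each arc from place $p$ to transition $q$, and a weight $\alpha_{pq}>0$ for each arc from transition $q$ to place $p$. Each place $p$ is of one of two kinds. Either $p$ is ruled by (proportional) preselection: a probability vector $(\pi_{qp})_{q\in p^{\mathrm{out}}}$ is given, and every $q\in p^{\mathrm{out}}$ has $p$ as its only upstream place. Or $p$ has at most one downstream transition $q$, and then one sets $\pi_{qp}=1$. The counter function $z_q(t)$ represents the (real-valued) number of firings of $q$ up to time $t$. In a semi-Markov decision process with finite state set $S$ and finite action sets $A_i$ ($i\in S$), playing action $a\in A_i$ in state $i$ incurs a cost $r_i^a$, a holding time $t_i^a\ge 0$, multiplies future costs by the discount factor $\gamma_i^a\ge0$ (values larger than $1$ are allowed; the factor may depend on $i$ and $a$, hence "controlled"), and leads to state $j$ with probability $P_{ij}^a$, $\sum_{j}P_{ij}^a=1$. *)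

theory Defs
  imports Complex_Main
begin

text \<open>
  Weights and routing probabilities carry the head of the arc first: \<open>weight N q p\<close> is
  \<open>\<alpha>\<^bsub>qp\<^esub>\<close> for an arc from place \<open>p\<close> to transition \<open>q\<close>, and \<open>weight N p q\<close> is
  \<open>\<alpha>\<^bsub>pq\<^esub>\<close> for an arc from transition \<open>q\<close> to place \<open>p\<close>.
  The component \<open>presel\<close> is the set of places ruled by preselection, and \<open>presel_prob N q p\<close> is
  meaningful only for \<open>p\<close> in that set and \<open>q\<close> downstream of \<open>p\<close>.
\<close>

record 'v petri_net =
  places :: "'v set"
  transitions :: "'v set"
  arcs :: "('v \<times> 'v) set"
  marking :: "'v \<Rightarrow> real"
  holding_time :: "'v \<Rightarrow> real"
  weight :: "'v \<Rightarrow> 'v \<Rightarrow> real"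
  presel :: "'v set"
  presel_prob :: "'v \<Rightarrow> 'v \<Rightarrow> real"

definition upstream :: "('v, 'm) petri_net_scheme \<Rightarrow> 'v \<Rightarrow> 'v set" where
  "upstream N x = {y. (y, x) \<in> arcs N}"

definition downstream :: "('v, 'm) petri_net_scheme \<Rightarrow> 'v \<Rightarrow> 'v set" where
  "downstream N x = {y. (x, y) \<in> arcs N}"

definition routing :: "('v, 'm) petri_net_scheme \<Rightarrow> 'v \<Rightarrow> 'v \<Rightarrow> real" where
  "routing N q p = (if p \<in> presel N then presel_prob N q p else 1)"

locale fluid_petri_net_without_priority =
  fixes N :: "('v, 'm) petri_net_scheme" (structure)
  assumes finite_places: "finite (places N)"
    and finite_transitions: "finite (transitions N)"
    and disjoint: "places N \<inter> transitions N = {}"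
    and bipartite: "arcs N \<subseteq> places N \<times> transitions N \<union> transitions N \<times> places N"
    and upstream_nonempty: "\<And>q. q \<in> transitions N \<Longrightarrow> upstream N q \<noteq> {}"
    and marking_nonneg: "\<And>p. p \<in> places N \<Longrightarrow> 0 \<le> marking N p"
    and holding_time_nonneg: "\<And>p. p \<in> places N \<Longrightarrow> 0 \<le> holding_time N p"
    and weight_pos: "\<And>x y. (y, x) \<in> arcs N \<Longrightarrow> 0 < weight N x y"
    and presel_places: "presel N \<subseteq> places N"
    and presel_prob_nonneg:
      "\<And>p q. p \<in> presel N \<Longrightarrow> q \<in> downstream N p \<Longrightarrow> 0 \<le> presel_prob N q p"
    and presel_prob_sum:
      "\<And>p. p \<in> presel N \<Longrightarrow> (\<Sum>q\<in>downstream N p. presel_prob N q p) = 1"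
    and presel_only_upstream:
      "\<And>p q. p \<in> presel N \<Longrightarrow> q \<in> downstream N p \<Longrightarrow> upstream N q = {p}"
    and non_presel_downstream:
      "\<And>p. p \<in> places N - presel N \<Longrightarrow> card (downstream N p) \<le> 1"

definition counter_equations ::
  "('v, 'm) petri_net_scheme \<Rightarrow> ('v \<Rightarrow> real \<Rightarrow> real) \<Rightarrow> real \<Rightarrow> bool" where
  "counter_equations N z t \<longleftrightarrow>
    (\<forall>q\<in>transitions N. z q t =
      (MIN p\<in>upstream N q. routing N q p * inverse (weight N q p) *
        (marking N p + (\<Sum>q'\<in>upstream N p. weight N p q' * z q' (t - holding_time N p)))))"

record ('s, 'a) smdp =
  states :: "'s set"
  actions :: "'s \<Rightarrow> 'a set"
  cost :: "'s \<Rightarrow> 'a \<Rightarrow> real"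
  duration :: "'s \<Rightarrow> 'a \<Rightarrow> real"
  discount :: "'s \<Rightarrow> 'a \<Rightarrow> real"
  trans_prob :: "'s \<Rightarrow> 'a \<Rightarrow> 's \<Rightarrow> real"

locale semi_markov_decision_process =
  fixes M :: "('s, 'a, 'm) smdp_scheme" (structure)
  assumes finite_states: "finite (states M)"
    and finite_actions: "\<And>i. i \<in> states M \<Longrightarrow> finite (actions M i)"
    and duration_nonneg: "\<And>i a. i \<in> states M \<Longrightarrow> a \<in> actions M i \<Longrightarrow> 0 \<le> duration M i a"
    and discount_nonneg: "\<And>i a. i \<in> states M \<Longrightarrow> a \<in> actions M i \<Longrightarrow> 0 \<le> discount M i a"
    and trans_prob_nonneg:
      "\<And>i a j. i \<in> states M \<Longrightarrow> a \<in> actions M i \<Longrightarrow> j \<in> states M \<Longrightarrow> 0 \<le> trans_prob M i a j"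
    and trans_prob_sum:
      "\<And>i a. i \<in> states M \<Longrightarrow> a \<in> actions M i \<Longrightarrow> (\<Sum>j\<in>states M. trans_prob M i a j) = 1"

definition dp_equations ::
  "('s, 'a, 'm) smdp_scheme \<Rightarrow> ('s \<Rightarrow> real \<Rightarrow> real) \<Rightarrow> real \<Rightarrow> bool" where
  "dp_equations M v t \<longleftrightarrow>
    (\<forall>i\<in>states M. v i t =
      (MIN a\<in>actions M i. cost M i a +
        discount M i a * (\<Sum>j\<in>states M. trans_prob M i a j * v j (t - duration M i a))))"

end

theory Submission
  imports Defs
begin

text \<open>
  Both systems of equations are minima over the same set \<open>upstream N q\<close>, so it suffices to match
  them term by term. The term of a place \<open>p\<close> is an affine function of the delayed counters
  \<open>z\<^bsub>q'\<^esub>(t - \<tau>\<^bsub>p\<^esub>)\<close> with coefficients \<open>\<kappa> \<alpha>\<^bsub>pq'\<^esub>\<close>, where \<open>\<kappa> = \<pi>\<^bsub>qp\<^esub> / \<alpha>\<^bsub>qp\<^esub>\<close>. In the absence of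
  priority rules these coefficients are nonnegative, and any nonnegative family is its total mass
  times a probability vector. Hence the cost is \<open>\<kappa> m\<^bsub>p\<^esub>\<close>, the holding time is \<open>\<tau>\<^bsub>p\<^esub>\<close>, the discount
  factor is the total mass \<open>\<kappa> \<Sum>\<^bsub>q'\<^esub> \<alpha>\<^bsub>pq'\<^esub>\<close>, and the transition probabilities are the normalised
  weights \<open>\<alpha>\<^bsub>pq'\<^esub> / \<Sum> \<alpha>\<close>. The discount factor may exceed one, because the net need not
  conserve tokens.

  One case escapes the normalisation: a place without upstream transitions has total mass zero.
  Its discount factor is then zero, and every probability vector serves.
\<close>

definition total_weight :: "('v, 'm) petri_net_scheme \<Rightarrow> 'v \<Rightarrow> real" where
  "total_weight N p = (\<Sum>q'\<in>upstream N p. weight N p q')"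

definition firing_rate :: "('v, 'm) petri_net_scheme \<Rightarrow> 'v \<Rightarrow> 'v \<Rightarrow> real" where
  "firing_rate N q p = routing N q p * inverse (weight N q p)"

text \<open>
  At a place without upstream transitions the process stays at \<open>q\<close>, which is an arbitrary choice
  of a probability vector on the states.
\<close>

definition petri_net_smdp :: "('v, 'm) petri_net_scheme \<Rightarrow> ('v, 'v) smdp" where
  "petri_net_smdp N =
    \<lparr>states = transitions N,
     actions = upstream N,
     cost = (\<lambda>q p. firing_rate N q p * marking N p),
     duration = (\<lambda>q p. holding_time N p),
     discount = (\<lambda>q p. firing_rate N q p * total_weight N p),
     trans_prob = (\<lambda>q p q'.
       if upstream N p = {} then of_bool (q' = q)
       else of_bool (q' \<in> upstream N p) * weight N p q' / total_weight N p)\<rparr>"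

context fluid_petri_net_without_priority
begin

lemma upstream_transition: "q \<in> transitions N \<Longrightarrow> upstream N q \<subseteq> places N"
  using bipartite disjoint by (auto simp: upstream_def)

lemma upstream_place: "p \<in> places N \<Longrightarrow> upstream N p \<subseteq> transitions N"
  using bipartite disjoint by (auto simp: upstream_def)

lemma total_weight_pos:
  assumes "p \<in> places N" "upstream N p \<noteq> {}"
  shows "0 < total_weight N p"
  unfolding total_weight_def
proof (rule sum_pos)
  show "finite (upstream N p)"
    using assms(1) upstream_place finite_transitions by (blast intro: finite_subset)
qed (use assms weight_pos in \<open>auto simp: upstream_def\<close>)

lemma total_weight_nonneg: "p \<in> places N \<Longrightarrow> 0 \<le> total_weight N p"
  using total_weight_pos[of p] by (cases "upstream N p = {}") (auto simp: total_weight_def)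

lemma firing_rate_nonneg:
  assumes "p \<in> upstream N q"
  shows "0 \<le> firing_rate N q p"
proof -
  have "0 \<le> routing N q p"
    using assms presel_prob_nonneg[of p q]
    by (simp add: routing_def upstream_def downstream_def)
  moreover have "0 < weight N q p"
    using assms weight_pos by (simp add: upstream_def)
  ultimately show ?thesis
    by (simp add: firing_rate_def)
qed

text \<open>
  Restricting a sum over all transitions to those upstream of \<open>p\<close> is what turns expectations under
  the transition probabilities into the weighted sums of the net.
\<close>

lemma sum_of_bool_upstream:
  fixes f :: "'v \<Rightarrow> real"
  assumes "p \<in> places N"
  shows "(\<Sum>q'\<in>transitions N. of_bool (q' \<in> upstream N p) * f q') = (\<Sum>q'\<in>upstream N p. f q')"
proof -
  have "transitions N \<inter> upstream N p = upstream N p"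
    using upstream_place[OF assms] by blast
  then show ?thesis
    using sum.inter_restrict[OF finite_transitions, of f "upstream N p"]
    by (simp add: of_bool_def if_distrib[where f = "\<lambda>x. x * _"] cong: if_cong)
qed

lemma trans_prob_petri_net_smdp_sum:
  assumes "q \<in> transitions N" "p \<in> places N"
  shows "(\<Sum>q'\<in>transitions N. trans_prob (petri_net_smdp N) q p q') = 1"
proof (cases "upstream N p = {}")
  case True
  then show ?thesis
    using assms finite_transitions by (simp add: petri_net_smdp_def of_bool_def)
next
  case False
  then show ?thesis
    using sum_of_bool_upstream[OF assms(2), of "weight N p"] total_weight_pos[OF assms(2)]
    by (simp add: petri_net_smdp_def total_weight_def flip: sum_divide_distrib)
qed

lemma semi_markov_decision_process_petri_net_smdp:
  "semi_markov_decision_process (petri_net_smdp N)"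
proof
  fix q p
  assume "q \<in> states (petri_net_smdp N)" "p \<in> actions (petri_net_smdp N) q"
  then have q: "q \<in> transitions N" and pq: "p \<in> upstream N q"
    by (simp_all add: petri_net_smdp_def)
  have p: "p \<in> places N"
    using q pq upstream_transition by blast
  show "0 \<le> duration (petri_net_smdp N) q p"
    using holding_time_nonneg[OF p] by (simp add: petri_net_smdp_def)
  show "0 \<le> discount (petri_net_smdp N) q p"
    using firing_rate_nonneg[OF pq] total_weight_nonneg[OF p] by (simp add: petri_net_smdp_def)
  show "(\<Sum>q'\<in>states (petri_net_smdp N). trans_prob (petri_net_smdp N) q p q') = 1"
    using trans_prob_petri_net_smdp_sum[OF q p] by (simp add: petri_net_smdp_def)
  show "0 \<le> trans_prob (petri_net_smdp N) q p q'" for q'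
    using weight_pos[of q' p] total_weight_nonneg[OF p]
    by (auto simp: petri_net_smdp_def upstream_def of_bool_def intro: less_imp_le)
next
  show "finite (states (petri_net_smdp N))"
    using finite_transitions by (simp add: petri_net_smdp_def)
next
  fix q
  assume "q \<in> states (petri_net_smdp N)"
  then show "finite (actions (petri_net_smdp N) q)"
    using upstream_transition[of q] finite_places
    by (auto simp: petri_net_smdp_def intro: finite_subset)
qed

lemma discount_petri_net_smdp_expectation:
  assumes "p \<in> places N"
  shows "discount (petri_net_smdp N) q p *
      (\<Sum>q'\<in>transitions N. trans_prob (petri_net_smdp N) q p q' * f q') =
    firing_rate N q p * (\<Sum>q'\<in>upstream N p. weight N p q' * f q')"
proof (cases "upstream N p = {}")
  case True
  then show ?thesis
    by (simp add: petri_net_smdp_def total_weight_def)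
next
  case False
  have "(\<Sum>q'\<in>transitions N. trans_prob (petri_net_smdp N) q p q' * f q') =
      (\<Sum>q'\<in>transitions N. of_bool (q' \<in> upstream N p) * (weight N p q' * f q')) / total_weight N p"
    using False by (simp add: petri_net_smdp_def sum_divide_distrib mult.assoc)
  then show ?thesis
    using sum_of_bool_upstream[OF assms] total_weight_pos[OF assms False]
    by (simp add: petri_net_smdp_def)
qed

lemma counter_equations_iff_dp_equations:
  "counter_equations N z t \<longleftrightarrow> dp_equations (petri_net_smdp N) z t"
proof -
  have "routing N q p * inverse (weight N q p) *
      (marking N p + (\<Sum>q'\<in>upstream N p. weight N p q' * z q' (t - holding_time N p))) =
    cost (petri_net_smdp N) q p + discount (petri_net_smdp N) q p *
      (\<Sum>q'\<in>transitions N. trans_prob (petri_net_smdp N) q p q' *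
        z q' (t - duration (petri_net_smdp N) q p))"
    if "q \<in> transitions N" "p \<in> upstream N q" for q p
  proof -
    have "p \<in> places N"
      using that upstream_transition by blast
    then show ?thesis
      unfolding discount_petri_net_smdp_expectation[OF \<open>p \<in> places N\<close>]
      by (simp add: petri_net_smdp_def firing_rate_def distrib_left)
  qed
  moreover have "states (petri_net_smdp N) = transitions N"
    and "actions (petri_net_smdp N) = upstream N"
    by (simp_all add: petri_net_smdp_def)
  ultimately show ?thesis
    unfolding counter_equations_def dp_equations_def by (simp cong: image_cong)
qed

end

theorem mainTheorem1:
  fixes N :: "'v petri_net"
  assumes "fluid_petri_net_without_priority N"
  shows "\<exists>M :: ('v, 'v) smdp.
    semi_markov_decision_process M \<and>
    states M = transitions N \<and>
    (\<forall>q\<in>transitions N. actions M q = upstream N q) \<and>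
    (\<forall>(z :: 'v \<Rightarrow> real \<Rightarrow> real) t. counter_equations N z t \<longleftrightarrow> dp_equations M z t)"
proof (intro exI conjI)
  interpret fluid_petri_net_without_priority N
    by (fact assms)
  show "semi_markov_decision_process (petri_net_smdp N)"
    by (fact semi_markov_decision_process_petri_net_smdp)
  show "states (petri_net_smdp N) = transitions N"
    and "\<forall>q\<in>transitions N. actions (petri_net_smdp N) q = upstream N q"
    by (simp_all add: petri_net_smdp_def)
  show "\<forall>z t. counter_equations N z t \<longleftrightarrow> dp_equations (petri_net_smdp N) z t"
    using counter_equations_iff_dp_equations by blast
qed

end
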